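(* Let $k<-2$ be fixed and $p\neq 0$ real. The inequality $$\frac{2}{k+2}\left( \frac{\sinh x}{x}\right) ^{kp}+\frac{k}{k+2}\left( \frac{\tanh x}{x}\right) ^{p}<1$$ holds for all $x\in (0,\infty)$ if and only if $p<0$ or $p\geq -\dfrac{12}{5(k+2)}$. *)

theory Defs
  imports Complex_Main
begin

end

theory Submission
  imports Defs "HOL-Real_Asymp.Real_Asymp"
begin

text \<open>Put \<open>S = sinh x / x\<close> and \<open>T = tanh x / x\<close>. For \<open>p > 0\<close> the left-hand side tends to 1 at 0, and it
  decreases as soon as \<open>2 S\<^bsup>kp\<^esup> (ln S)' < - T\<^bsup>p\<^esup> (ln T)'\<close>. Because \<open>S\<^sup>2 T > 1\<close> (Lazarevic's inequality
  \<open>S\<^sup>3 > cosh x\<close>) and \<open>(k + 2) p \<le> - 12/5\<close>, this follows from the parameter-free inequality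
  \<open>2 (ln S)' < - S\<^bsup>12/5\<^esup> (ln T)'\<close>, in which \<open>S\<^bsup>12/5\<^esup>\<close> may be weakened to \<open>(cosh x)\<^bsup>4/5\<^esup>\<close>. The constant
  \<open>12/5\<close> is forced by the coefficient of \<open>x\<^sup>4\<close> at 0. For \<open>p < 0\<close>, \<open>S\<^sup>2 T > 1\<close> reduces the claim to
  Bernoulli's inequality for \<open>S\<^bsup>-2p\<^esup>\<close> with exponent \<open>-k/2 > 1\<close>.\<close>

section \<open>Monotonicity criterion and elementary hyperbolic inequalities\<close>

lemma pos_if_tendsto_0_and_deriv_pos:
  fixes f :: "real \<Rightarrow> real"
  assumes lim: "(f \<longlongrightarrow> 0) (at_right 0)"
    and deriv: "\<And>x. x > 0 \<Longrightarrow> (f has_real_derivative f' x) (at x)"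
    and pos: "\<And>x. x > 0 \<Longrightarrow> f' x > 0"
    and x: "x > 0"
  shows "f x > 0"
proof -
  have mono: "f a < f b" if "0 < a" "a < b" for a b
  proof (rule DERIV_pos_imp_increasing[where f = f])
    fix x assume "a \<le> x"
    then have "x > 0" using that by simp
    then show "\<exists>y. (f has_real_derivative y) (at x) \<and> y > 0"
      using deriv pos by blast
  qed (rule that)
  \<comment> \<open>A limit preserves only non-strict bounds, so it is compared with the value at
    \<open>x / 2\<close>; monotonicity from there to \<open>x\<close> restores strictness.\<close>
  have "\<forall>\<^sub>F y in at_right 0. f y \<le> f (x / 2)"
    using x by (intro eventually_at_rightI[of 0 "x / 2"] less_imp_le mono) auto
  then have "0 \<le> f (x / 2)"
    using lim by (intro tendsto_upperbound[of f 0 "at_right 0"]) auto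
  also have "\<dots> < f x"
    using x by (intro mono) auto
  finally show ?thesis .
qed

lemma x_cosh_gt_sinh:
  fixes x :: real
  assumes "x > 0"
  shows "sinh x < x * cosh x"
proof -
  have "x * cosh x - sinh x > 0"
  proof (rule pos_if_tendsto_0_and_deriv_pos[where f = "\<lambda>x. x * cosh x - sinh x" and f' = "\<lambda>x. x * sinh x"])
    show "((\<lambda>x::real. x * cosh x - sinh x) \<longlongrightarrow> 0) (at_right 0)"
      by real_asymp
  qed (use assms in \<open>auto intro!: derivative_eq_intros\<close>)
  then show ?thesis by simp
qed

lemma x_less_sinh:
  fixes x :: real
  assumes "x > 0"
  shows "x < sinh x"
proof -
  have "sinh x - x > 0"
  proof (rule pos_if_tendsto_0_and_deriv_pos[where f = "\<lambda>x. sinh x - x" and f' = "\<lambda>x. cosh x - 1"])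
    show "((\<lambda>x::real. sinh x - x) \<longlongrightarrow> 0) (at_right 0)"
      by real_asymp
  next
    fix x :: real assume "x > 0"
    then show "cosh x - 1 > 0"
      using cosh_real_strict_mono[of 0 x] by simp
  qed (use assms in \<open>auto intro!: derivative_eq_intros\<close>)
  then show ?thesis by simp
qed

text \<open>Together with \<open>x_cosh_gt_sinh\<close>, this makes the numerators of
  \<open>- (ln T)'\<close> and \<open>(ln S)'\<close> positive.\<close>

lemma x_less_sinh_cosh:
  fixes x :: real
  assumes "x > 0"
  shows "x < sinh x * cosh x"
  using x_less_sinh[of "2 * x"] assms by (simp add: sinh_double)

text \<open>Hyperbolic form of the Cusa-Huygens inequality; two differentiations reduce it to
  \<open>x_cosh_gt_sinh\<close>.\<close>

lemma three_sinh_less: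
  fixes y :: real
  assumes "y > 0"
  shows "3 * sinh y < y * (cosh y + 2)"
proof -
  have 1: "y * sinh y - 2 * cosh y + 2 > 0" if "y > 0" for y :: real
  proof (rule pos_if_tendsto_0_and_deriv_pos[where f = "\<lambda>y. y * sinh y - 2 * cosh y + 2"
        and f' = "\<lambda>y. y * cosh y - sinh y"])
    show "((\<lambda>y::real. y * sinh y - 2 * cosh y + 2) \<longlongrightarrow> 0) (at_right 0)"
      by real_asymp
  next
    fix y :: real assume y: "y > 0"
    show "((\<lambda>y. y * sinh y - 2 * cosh y + 2) has_real_derivative y * cosh y - sinh y) (at y)"
      by (auto intro!: derivative_eq_intros)
    show "y * cosh y - sinh y > 0"
      using x_cosh_gt_sinh[OF y] by simp
  qed (rule that)
  have "y * (cosh y + 2) - 3 * sinh y > 0"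
  proof (rule pos_if_tendsto_0_and_deriv_pos[where f = "\<lambda>y. y * (cosh y + 2) - 3 * sinh y"
        and f' = "\<lambda>y. y * sinh y - 2 * cosh y + 2"])
    show "((\<lambda>y::real. y * (cosh y + 2) - 3 * sinh y) \<longlongrightarrow> 0) (at_right 0)"
      by real_asymp
  next
    fix y :: real assume y: "y > 0"
    show "((\<lambda>y. y * (cosh y + 2) - 3 * sinh y) has_real_derivative
        y * sinh y - 2 * cosh y + 2) (at y)"
      by (auto intro!: derivative_eq_intros simp: algebra_simps)
    show "y * sinh y - 2 * cosh y + 2 > 0"
      by (rule 1[OF y])
  qed (rule assms)
  then show ?thesis by simp
qed

text \<open>The difference of the logarithms tends to 0 at 0 and increases: its derivative is
  positive by \<open>three_sinh_less\<close> at \<open>2 * x\<close>.\<close>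

lemma Lazarevic:
  fixes x :: real
  assumes "x > 0"
  shows "cosh x < (sinh x / x) ^ 3"
proof -
  have "3 * ln (sinh x / x) - ln (cosh x) > 0"
  proof (rule pos_if_tendsto_0_and_deriv_pos[where f = "\<lambda>x. 3 * ln (sinh x / x) - ln (cosh x)"
        and f' = "\<lambda>x. 3 * (x * cosh x - sinh x) / (x * sinh x) - sinh x / cosh x"])
    show "((\<lambda>x::real. 3 * ln (sinh x / x) - ln (cosh x)) \<longlongrightarrow> 0) (at_right 0)"
      by real_asymp
  next
    fix x :: real assume x: "x > 0"
    show "((\<lambda>x. 3 * ln (sinh x / x) - ln (cosh x)) has_real_derivative
        3 * (x * cosh x - sinh x) / (x * sinh x) - sinh x / cosh x) (at x)"
      using x by (auto intro!: derivative_eq_intros simp: field_simps power2_eq_square)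
    have "3 * sinh (2 * x) < 2 * x * (cosh (2 * x) + 2)"
      using three_sinh_less[of "2 * x"] x by simp
    then have "x * sinh x ^ 2 < 3 * (x * cosh x - sinh x) * cosh x"
      unfolding sinh_double cosh_double_cosh sinh_square_eq
      by (simp add: algebra_simps power2_eq_square)
    then show "3 * (x * cosh x - sinh x) / (x * sinh x) - sinh x / cosh x > 0"
      using x by (simp add: field_simps power2_eq_square)
  qed (use assms in auto)
  then have "ln (cosh x) < ln ((sinh x / x) ^ 3)"
    using assms by (simp add: ln_realpow)
  then show ?thesis
    using assms by (subst (asm) ln_less_cancel_iff) auto
qed

section \<open>Power series and the bound on \<open>cosh x powr (1 / 5)\<close>\<close>

text \<open>The coefficient \<open>1 / (n - 1)!\<close> is written as \<open>n / n!\<close>, so that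
  the series can be added termwise to that of \<open>cosh\<close>; the factor \<open>n\<close> also
  gives the correct term 0 at \<open>n = 0\<close>.\<close>

lemma x_sinh_sums:
  fixes x :: real
  shows "(\<lambda>n. if even n then real n * x ^ n / fact n else 0) sums (x * sinh x)"
proof -
  have "(\<lambda>n. x * (if even n then 0 else x ^ n /\<^sub>R fact n)) sums (x * sinh x)"
    by (intro sums_mult sinh_converges)
  also have "(\<lambda>n. x * (if even n then 0 else x ^ n /\<^sub>R fact n)) =
      (\<lambda>n. if even (Suc n) then real (Suc n) * x ^ Suc n / fact (Suc n) else 0)"
    by (auto simp: fun_eq_iff field_simps simp del: of_nat_Suc)
  finally show ?thesis
    by (subst (asm) sums_Suc_iff) simp
qed

text \<open>Likewise \<open>1 / (n - 2)! = n (n - 1) / n!\<close>, which vanishes at the two indices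
  added by the shift.\<close>

lemma x2_cosh_sums:
  fixes x :: real
  shows "(\<lambda>n. if even n then real n * (real n - 1) * x ^ n / fact n else 0) sums (x ^ 2 * cosh x)"
proof -
  let ?f = "\<lambda>n. if even n then real n * (real n - 1) * x ^ n / fact n else 0"
  have "(\<lambda>n. x ^ 2 * (if even n then x ^ n /\<^sub>R fact n else 0)) sums (x ^ 2 * cosh x)"
    by (intro sums_mult cosh_converges)
  also have "(\<lambda>n. x ^ 2 * (if even n then x ^ n /\<^sub>R fact n else 0)) = (\<lambda>n. ?f (n + 2))"
  proof
    fix n
    define c where "c = real (n + 2) * (real (n + 2) - 1)"
    have "c > 0"
      unfolding c_def by (intro mult_pos_pos) auto
    moreover have "fact (n + 2) = c * fact n"
      by (simp add: c_def algebra_simps)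
    ultimately show "x ^ 2 * (if even n then x ^ n /\<^sub>R fact n else 0) = ?f (n + 2)"
      unfolding c_def[symmetric] by (simp add: divide_simps power_add power2_eq_square del: fact_Suc)
  qed
  finally show ?thesis
    by (subst (asm) sums_iff_shift) (simp add: numeral_2_eq_2)
qed

text \<open>The left-hand side equals
  \<open>x sinh 3x - 9/4 cosh 3x + 9/4 cosh x + 6 x\<^sup>2 cosh x\<close>, a power series with nonnegative coefficients
  starting at \<open>x\<^sup>8\<close>.\<close>

lemma sinh_cosh_cubic_pos:
  fixes x :: real
  assumes "x > 0"
  shows "4 * x * sinh x * cosh x ^ 2 - 9 * sinh x ^ 2 * cosh x + 6 * x ^ 2 * cosh x - x * sinh x > 0"
proof -
  define a :: "nat \<Rightarrow> real" where
    "a n = 3 ^ n * (real n / 3 - 9 / 4) + 9 / 4 + 6 * real n * (real n - 1)" for n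
  define f where "f n = (if even n then a n * x ^ n / fact n else 0)" for n
  have "(\<lambda>n. 1 / 3 * (if even n then real n * (3 * x) ^ n / fact n else 0)
          - 9 / 4 * (if even n then (3 * x) ^ n /\<^sub>R fact n else 0)
          + 9 / 4 * (if even n then x ^ n /\<^sub>R fact n else 0)
          + 6 * (if even n then real n * (real n - 1) * x ^ n / fact n else 0))
      sums (1 / 3 * (3 * x * sinh (3 * x)) - 9 / 4 * cosh (3 * x) + 9 / 4 * cosh x + 6 * (x ^ 2 * cosh x))"
    by (intro sums_add sums_diff sums_mult x_sinh_sums cosh_converges x2_cosh_sums)
  also have "(\<lambda>n. 1 / 3 * (if even n then real n * (3 * x) ^ n / fact n else 0)
          - 9 / 4 * (if even n then (3 * x) ^ n /\<^sub>R fact n else 0)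
          + 9 / 4 * (if even n then x ^ n /\<^sub>R fact n else 0)
          + 6 * (if even n then real n * (real n - 1) * x ^ n / fact n else 0)) = f"
    by (auto simp: fun_eq_iff f_def a_def field_simps power_mult_distrib)
  finally have sums: "f sums (1 / 3 * (3 * x * sinh (3 * x)) - 9 / 4 * cosh (3 * x) + 9 / 4 * cosh x
      + 6 * (x ^ 2 * cosh x))" .
  \<comment> \<open>Here \<open>n / 3 > 9 / 4\<close>, so no summand of \<open>a n\<close> is
    negative.\<close>
  have a_pos: "a n > 0" if "n \<ge> 8" for n
    unfolding a_def using that by (intro add_pos_nonneg) auto
  have "f n \<ge> 0" for n
  proof (cases "n \<ge> 8")
    case True
    then show ?thesis using a_pos[of n] assms by (auto simp: f_def intro!: divide_nonneg_pos)
  next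
    case False
    \<comment> \<open>The odd terms are 0 by definition, and \<open>a 0\<close>, \<open>a 2\<close>,
      \<open>a 4\<close>, \<open>a 6\<close> all vanish.\<close>
    then have "n \<in> {0, 1, 2, 3, 4, 5, 6, 7}" by auto
    then show ?thesis by (auto simp: f_def a_def)
  qed
  moreover have "f 8 > 0"
    using a_pos[of 8] assms by (auto simp: f_def)
  ultimately have "suminf f > 0"
    using sums by (intro suminf_pos2[of f 8]) (auto simp: sums_iff)
  then have *: "1 / 3 * (3 * x * sinh (3 * x)) - 9 / 4 * cosh (3 * x) + 9 / 4 * cosh x
      + 6 * (x ^ 2 * cosh x) > 0"
    using sums by (simp add: sums_iff)
  have s2: "sinh x ^ 2 = cosh x ^ 2 - 1"
    by (simp add: sinh_square_eq)
  have "sinh (3 * x) = 2 * sinh x * cosh x * cosh x + (cosh x ^ 2 + sinh x ^ 2) * sinh x"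
    using sinh_add[of "2 * x" x] by (simp only: sinh_double cosh_double) simp
  also have "\<dots> = 4 * sinh x * cosh x ^ 2 - sinh x"
    unfolding s2 by (simp add: algebra_simps power2_eq_square)
  finally have sinh3: "sinh (3 * x) = 4 * sinh x * cosh x ^ 2 - sinh x" .
  have "cosh (3 * x) = (cosh x ^ 2 + sinh x ^ 2) * cosh x + 2 * sinh x * cosh x * sinh x"
    using cosh_add[of "2 * x" x] by (simp only: sinh_double cosh_double) simp
  also have "\<dots> = cosh x * (cosh x ^ 2 + 3 * sinh x ^ 2)"
    by (simp add: algebra_simps power2_eq_square)
  \<comment> \<open>In this form \<open>9 / 4 * (cosh (3 * x) - cosh x)\<close> collapses to
    \<open>9 * sinh x ^ 2 * cosh x\<close>.\<close>
  also have "\<dots> = 4 * sinh x ^ 2 * cosh x + cosh x"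
    unfolding cosh_square_eq by (simp add: algebra_simps)
  finally have cosh3: "cosh (3 * x) = 4 * sinh x ^ 2 * cosh x + cosh x" .
  from * show ?thesis
    unfolding sinh3 cosh3 by (simp add: algebra_simps)
qed

text \<open>Both sides behave like \<open>2 x^3 / 3\<close> at 0, so the logarithm of their quotient
  tends to 0; it increases by the cubic inequality above.\<close>

lemma cosh_powr_fifth_less:
  fixes x :: real
  assumes "x > 0"
  shows "2 * (x * cosh x - sinh x) * cosh x powr (1 / 5) < sinh x * cosh x - x"
proof -
  have "ln ((sinh x * cosh x - x) / (2 * (x * cosh x - sinh x))) - 1 / 5 * ln (cosh x) > 0"
  proof (rule pos_if_tendsto_0_and_deriv_pos[where
        f = "\<lambda>x. ln ((sinh x * cosh x - x) / (2 * (x * cosh x - sinh x))) - 1 / 5 * ln (cosh x)"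
        and f' = "\<lambda>x. 2 * sinh x ^ 2 / (sinh x * cosh x - x) - x * sinh x / (x * cosh x - sinh x)
          - sinh x / (5 * cosh x)"])
    show "((\<lambda>x::real. ln ((sinh x * cosh x - x) / (2 * (x * cosh x - sinh x))) - 1 / 5 * ln (cosh x))
        \<longlongrightarrow> 0) (at_right 0)"
      by real_asymp
  next
    fix x :: real assume x: "x > 0"
    define A B where "A = sinh x * cosh x - x" and "B = x * cosh x - sinh x"
    have AB: "A > 0" "B > 0"
      using x_less_sinh_cosh[OF x] x_cosh_gt_sinh[OF x] by (auto simp: A_def B_def)
    have s2: "cosh x ^ 2 = sinh x ^ 2 + 1"
      by (simp add: cosh_square_eq)
    have "((\<lambda>x. ln (sinh x * cosh x - x) - ln (2 * (x * cosh x - sinh x)) - 1 / 5 * ln (cosh x))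
        has_real_derivative
          2 * sinh x ^ 2 / A - x * sinh x / B - sinh x / (5 * cosh x)) (at x)"
    proof -
      have dA: "((\<lambda>x. sinh x * cosh x - x) has_real_derivative 2 * sinh x ^ 2) (at x)"
        using s2 by (auto intro!: derivative_eq_intros simp: power2_eq_square)
      have dB: "((\<lambda>x. 2 * (x * cosh x - sinh x)) has_real_derivative 2 * (x * sinh x)) (at x)"
        by (auto intro!: derivative_eq_intros simp: algebra_simps)
      have "((\<lambda>x. 1 / 5 * ln (cosh x)) has_real_derivative sinh x / (5 * cosh x)) (at x)"
        by (auto intro!: derivative_eq_intros)
      from DERIV_diff[OF DERIV_diff[OF DERIV_chain2[OF DERIV_ln_divide dA] DERIV_chain2[OF DERIV_ln_divide dB]] this]
      show ?thesis
        using AB by (simp add: A_def B_def del: right_diff_distrib_numeral)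
    qed
    \<comment> \<open>The limit at 0 needs the quotient, since the separate logarithms diverge
      there; the derivative was taken of their difference. The two are identified near
      \<open>x\<close>, where both arguments are positive.\<close>
    moreover have "\<forall>\<^sub>F y in nhds x. ln ((sinh y * cosh y - y) / (2 * (y * cosh y - sinh y))) - 1 / 5 * ln (cosh y)
        = ln (sinh y * cosh y - y) - ln (2 * (y * cosh y - sinh y)) - 1 / 5 * ln (cosh y)"
    proof (rule eventually_mono)
      show "\<forall>\<^sub>F y in nhds x. y \<in> {0<..}"
        using eventually_nhds_in_open[of "{0<..}" x] x by simp
    next
      fix y :: real assume "y \<in> {0<..}"
      then have "sinh y * cosh y - y > 0" "2 * (y * cosh y - sinh y) > 0"
        using x_less_sinh_cosh[of y] x_cosh_gt_sinh[of y] by auto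
      then show "ln ((sinh y * cosh y - y) / (2 * (y * cosh y - sinh y))) - 1 / 5 * ln (cosh y)
        = ln (sinh y * cosh y - y) - ln (2 * (y * cosh y - sinh y)) - 1 / 5 * ln (cosh y)"
        by (subst ln_div) auto
    qed
    ultimately show "((\<lambda>x. ln ((sinh x * cosh x - x) / (2 * (x * cosh x - sinh x))) - 1 / 5 * ln (cosh x))
        has_real_derivative 2 * sinh x ^ 2 / (sinh x * cosh x - x) - x * sinh x / (x * cosh x - sinh x)
          - sinh x / (5 * cosh x)) (at x)"
      by (subst DERIV_cong_ev[OF refl _ refl]) (auto simp: A_def B_def)
    \<comment> \<open>Up to the factor \<open>sinh x\<close>, this is the numerator of the
      derivative over \<open>5 * A * B * cosh x\<close>; expanded, it is the cubic expression of
      \<open>sinh_cosh_cubic_pos\<close>.\<close>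
    have "10 * sinh x * cosh x * B - 5 * x * cosh x * A - A * B > 0"
      using sinh_cosh_cubic_pos[OF x] by (simp add: A_def B_def algebra_simps power2_eq_square)
    then have "sinh x * (10 * sinh x * cosh x * B - 5 * x * cosh x * A - A * B) / (5 * A * B * cosh x) > 0"
      using x AB by simp
    also have "sinh x * (10 * sinh x * cosh x * B - 5 * x * cosh x * A - A * B) / (5 * A * B * cosh x)
       = 2 * sinh x ^ 2 / A - x * sinh x / B - sinh x / (5 * cosh x)"
      using x AB by (simp add: field_simps power2_eq_square)
    finally show "2 * sinh x ^ 2 / (sinh x * cosh x - x) - x * sinh x / (x * cosh x - sinh x)
          - sinh x / (5 * cosh x) > 0"
      by (simp add: A_def B_def)
  qed (use assms in auto)
  then have "ln (cosh x powr (1 / 5)) < ln ((sinh x * cosh x - x) / (2 * (x * cosh x - sinh x)))"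
    by (simp add: ln_powr)
  then have "cosh x powr (1 / 5) < (sinh x * cosh x - x) / (2 * (x * cosh x - sinh x))"
    using x_less_sinh_cosh[OF assms] x_cosh_gt_sinh[OF assms]
    by (subst (asm) ln_less_cancel_iff) auto
  then show ?thesis
    using x_cosh_gt_sinh[OF assms] by (simp add: field_simps)
qed

section \<open>Derivatives of powers of \<open>S\<close> and \<open>T\<close>, and comparison of
  their logarithmic derivatives\<close>

text \<open>The last factor is \<open>(ln S)'\<close>.\<close>

lemma has_real_derivative_sinh_div_powr:
  fixes x r :: real
  assumes "x > 0"
  shows "((\<lambda>x. (sinh x / x) powr r) has_real_derivative
    r * (sinh x / x) powr r * ((x * cosh x - sinh x) / (x * sinh x))) (at x)"
proof -
  have "((\<lambda>x. sinh x / x) has_real_derivative (x * cosh x - sinh x) / x ^ 2) (at x)"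
    using assms by (auto intro!: derivative_eq_intros simp: power2_eq_square algebra_simps)
  from DERIV_fun_powr[OF this, of r]
  have "((\<lambda>x. (sinh x / x) powr r) has_real_derivative
      r * (sinh x / x) powr (r - 1) * ((x * cosh x - sinh x) / x ^ 2)) (at x)"
    using assms by simp
  then show ?thesis
    using assms by (elim DERIV_cong) (simp add: powr_diff divide_simps power2_eq_square)
qed

text \<open>The last factor is \<open>- (ln T)'\<close>, kept positive by the sign in front.\<close>

lemma has_real_derivative_tanh_div_powr:
  fixes x r :: real
  assumes "x > 0"
  shows "((\<lambda>x. (tanh x / x) powr r) has_real_derivative
    - r * (tanh x / x) powr r * ((sinh x * cosh x - x) / (x * (sinh x * cosh x)))) (at x)"
proof -
  have "((\<lambda>x. sinh x / cosh x / x) has_real_derivative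
      (x * (cosh x ^ 2 - sinh x ^ 2) - sinh x * cosh x) / (x ^ 2 * cosh x ^ 2)) (at x)"
    using assms by (auto intro!: derivative_eq_intros simp: power2_eq_square field_simps)
  then have "((\<lambda>x. tanh x / x) has_real_derivative
      (x - sinh x * cosh x) / (x ^ 2 * cosh x ^ 2)) (at x)"
    unfolding hyperbolic_pythagoras tanh_def by simp
  also have "(x - sinh x * cosh x) / (x ^ 2 * cosh x ^ 2) =
      - (tanh x / x * ((sinh x * cosh x - x) / (x * (sinh x * cosh x))))"
    using assms by (simp add: tanh_def divide_simps power2_eq_square)
  finally have deriv: "((\<lambda>x. tanh x / x) has_real_derivative
      - (tanh x / x * ((sinh x * cosh x - x) / (x * (sinh x * cosh x))))) (at x)" .
  have T: "tanh x / x > 0"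
    using assms by simp
  \<comment> \<open>\<open>of_nat 1\<close> matches the exponent as it appears in
    \<open>DERIV_fun_powr\<close>.\<close>
  have "r * T powr (r - of_nat 1) * - (T * q) = - r * T powr r * q" if "T > 0" for T q :: real
    using that by (simp add: powr_diff)
  from DERIV_fun_powr[OF deriv T, of r, unfolded this[OF T]] show ?thesis .
qed

lemma tendsto_sinh_div_powr: "((\<lambda>x::real. (sinh x / x) powr r) \<longlongrightarrow> 1) (at_right 0)"
proof -
  have "((\<lambda>x::real. sinh x / x) \<longlongrightarrow> 1) (at_right 0)"
    by real_asymp
  from tendsto_powr[OF this tendsto_const[of r]] show ?thesis by simp
qed

lemma tendsto_tanh_div_powr: "((\<lambda>x::real. (tanh x / x) powr r) \<longlongrightarrow> 1) (at_right 0)"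
proof -
  have "((\<lambda>x::real. tanh x / x) \<longlongrightarrow> 1) (at_right 0)"
    by real_asymp
  from tendsto_powr[OF this tendsto_const[of r]] show ?thesis by simp
qed

text \<open>Split \<open>cosh x\<close> into its powers \<open>1 / 5\<close> and
  \<open>4 / 5\<close>: the first is absorbed by \<open>cosh_powr_fifth_less\<close>, the second is
  below \<open>S powr (12 / 5)\<close> by Lazarevic's inequality.\<close>

lemma log_deriv_comparison:
  fixes x :: real
  assumes x: "x > 0"
  shows "2 * ((x * cosh x - sinh x) / (x * sinh x)) <
    (sinh x / x) powr (12 / 5) * ((sinh x * cosh x - x) / (x * (sinh x * cosh x)))"
proof -
  define A B where "A = sinh x * cosh x - x" and "B = x * cosh x - sinh x"
  have AB: "A > 0" "B > 0"
    using x_less_sinh_cosh[OF x] x_cosh_gt_sinh[OF x] by (auto simp: A_def B_def)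
  have "cosh x powr (4 / 5) < ((sinh x / x) ^ 3) powr (4 / 5)"
    using Lazarevic[OF x] by (intro powr_less_mono2) auto
  also have "\<dots> = (sinh x / x) powr (12 / 5)"
    using x by (simp add: powr_powr flip: powr_numeral)
  finally have c45: "cosh x powr (4 / 5) < (sinh x / x) powr (12 / 5)" .
  have "2 * B * cosh x = 2 * B * cosh x powr (1 / 5) * cosh x powr (4 / 5)"
    using powr_add[of "cosh x" "1 / 5" "4 / 5"] by simp
  also have "\<dots> < A * cosh x powr (4 / 5)"
    using cosh_powr_fifth_less[OF x] by (intro mult_strict_right_mono) (auto simp: A_def B_def)
  also have "\<dots> < A * (sinh x / x) powr (12 / 5)"
    using c45 AB by simp
  finally have "2 * B * cosh x / (x * sinh x * cosh x) < A * (sinh x / x) powr (12 / 5) / (x * sinh x * cosh x)"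
    using x by (intro divide_strict_right_mono) auto
  then show ?thesis
    using x by (simp add: A_def B_def mult_ac)
qed

lemma sinh_div_gt_1:
  fixes x :: real
  assumes "x > 0"
  shows "sinh x / x > 1"
  using x_less_sinh[OF assms] assms by simp

text \<open>This is \<open>S^2 T > 1\<close>: write \<open>1 / T = cosh x / S\<close> and use
  \<open>cosh x < S^3\<close>.\<close>

lemma inverse_tanh_div_less:
  fixes x :: real
  assumes "x > 0"
  shows "1 / (tanh x / x) < (sinh x / x) ^ 2"
proof -
  have "1 / (tanh x / x) = cosh x / (sinh x / x)"
    by (simp add: tanh_def)
  also have "\<dots> < (sinh x / x) ^ 3 / (sinh x / x)"
    using Lazarevic[OF assms] assms by (intro divide_strict_right_mono) auto
  also have "\<dots> = (sinh x / x) ^ 2"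
    using assms by (simp add: power2_eq_square power3_eq_cube)
  finally show ?thesis .
qed

section \<open>Sufficiency of the conditions on \<open>p\<close>\<close>

lemma inequality_if_ge:
  fixes k p x :: real
  assumes k: "k < -2" and p: "p \<ge> - 12 / (5 * (k + 2))" and x: "x > 0"
  shows "2 / (k + 2) * (sinh x / x) powr (k * p) + k / (k + 2) * (tanh x / x) powr p < 1"
proof -
  have kp: "(k + 2) * p \<le> - 12 / 5"
    using p k by (simp add: field_simps)
  have "0 < - 12 / (5 * (k + 2))"
    using k by (intro divide_neg_neg) auto
  with p have "p > 0" by linarith
  \<comment> \<open>The common factor of both terms of the derivative, positive because
    \<open>k * p\<close> and \<open>k + 2\<close> are both negative.\<close>
  define c where "c = k * p / (k + 2)"
  have "c > 0"
    using k \<open>p > 0\<close> by (simp add: c_def divide_neg_neg mult_neg_pos)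
  let ?s = "\<lambda>x::real. (x * cosh x - sinh x) / (x * sinh x)"
  let ?t = "\<lambda>x::real. (sinh x * cosh x - x) / (x * (sinh x * cosh x))"
  have "1 - (2 / (k + 2) * (sinh x / x) powr (k * p) + k / (k + 2) * (tanh x / x) powr p) > 0"
  proof (rule pos_if_tendsto_0_and_deriv_pos[where
        f = "\<lambda>x. 1 - (2 / (k + 2) * (sinh x / x) powr (k * p) + k / (k + 2) * (tanh x / x) powr p)"
        and f' = "\<lambda>x. c * ((tanh x / x) powr p * ?t x - (sinh x / x) powr (k * p) * (2 * ?s x))"])
    have "2 / (k + 2) + k / (k + 2) = (k + 2) / (k + 2)"
      by (simp only: add_divide_distrib add.commute)
    also have "\<dots> = 1"
      using k by simp
    finally have sum1: "2 / (k + 2) + k / (k + 2) = 1" .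
    have "((\<lambda>x. 1 - (2 / (k + 2) * (sinh x / x) powr (k * p) + k / (k + 2) * (tanh x / x) powr p))
        \<longlongrightarrow> 1 - (2 / (k + 2) * 1 + k / (k + 2) * 1)) (at_right 0)"
      by (intro tendsto_intros tendsto_sinh_div_powr tendsto_tanh_div_powr)
    then show "((\<lambda>x. 1 - (2 / (k + 2) * (sinh x / x) powr (k * p) + k / (k + 2) * (tanh x / x) powr p))
        \<longlongrightarrow> 0) (at_right 0)"
      by (simp add: sum1)
  next
    fix x :: real assume x: "x > 0"
    have *: "0 - (2 / (k + 2) * (k * p * a * s) + k / (k + 2) * (- p * b * t)) = c * (b * t - a * (2 * s))"
      for a b s t :: real
      by (simp add: c_def divide_inverse algebra_simps)
    from DERIV_diff[OF DERIV_const DERIV_add[OF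
        DERIV_cmult[OF has_real_derivative_sinh_div_powr[OF x, of "k * p"], of "2 / (k + 2)"]
        DERIV_cmult[OF has_real_derivative_tanh_div_powr[OF x, of p], of "k / (k + 2)"]], of 1]
    show "((\<lambda>x. 1 - (2 / (k + 2) * (sinh x / x) powr (k * p) + k / (k + 2) * (tanh x / x) powr p))
        has_real_derivative
        c * ((tanh x / x) powr p * ?t x - (sinh x / x) powr (k * p) * (2 * ?s x))) (at x)"
      by (simp only: *)
    define S T s t where "S = sinh x / x" and "T = tanh x / x" and "s = ?s x" and "t = ?t x"
    have "S > 1" "T > 0" "s > 0" "t > 0"
      using x sinh_div_gt_1[OF x] x_less_sinh_cosh[OF x] x_cosh_gt_sinh[OF x]
      by (auto simp: S_def T_def s_def t_def)
    \<comment> \<open>By \<open>kp\<close>, \<open>k * p \<le> - 2 * p - 12 / 5\<close>, and the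
      base exceeds 1; this step eliminates \<open>k\<close>.\<close>
    have "S powr (k * p) * (2 * s) \<le> S powr (- (2 * p) - 12 / 5) * (2 * s)"
      using \<open>S > 1\<close> \<open>s > 0\<close> kp by (intro mult_right_mono powr_mono) (auto simp: algebra_simps)
    also have "\<dots> < S powr (- (2 * p) - 12 / 5) * (S powr (12 / 5) * t)"
      using log_deriv_comparison[OF x] \<open>S > 1\<close>
      by (intro mult_strict_left_mono) (auto simp: S_def s_def t_def)
    also have "\<dots> = (S ^ 2) powr (- p) * t"
      using \<open>S > 1\<close> by (simp add: powr_powr flip: powr_numeral powr_add)
    also have "\<dots> = (1 / S ^ 2) powr p * t"
      using \<open>S > 1\<close> by (simp add: powr_minus powr_divide divide_simps)
    also have "\<dots> < T powr p * t"
    proof (intro mult_strict_right_mono powr_less_mono2)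
      show "1 / S ^ 2 < T"
        using inverse_tanh_div_less[OF x] \<open>S > 1\<close> \<open>T > 0\<close>
        by (simp add: S_def[symmetric] T_def[symmetric] field_simps)
    qed (use \<open>p > 0\<close> \<open>t > 0\<close> in auto)
    finally show "c * ((tanh x / x) powr p * ?t x - (sinh x / x) powr (k * p) * (2 * ?s x)) > 0"
      using \<open>c > 0\<close> by (simp add: S_def T_def s_def t_def)
  qed (rule x)
  then show ?thesis by simp
qed

text \<open>Put \<open>w = exp u\<close>: the difference of the sides vanishes at
  \<open>u = 0\<close> and has derivative \<open>a * (exp (a * u) - exp u) > 0\<close>.\<close>

lemma Bernoulli_powr:
  fixes w a :: real
  assumes "w > 1" "a > 1"
  shows "1 + a * (w - 1) < w powr a"
proof -
  have "exp (a * ln w) - a * exp (ln w) + a - 1 > 0"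
  proof (rule pos_if_tendsto_0_and_deriv_pos[where f = "\<lambda>u. exp (a * u) - a * exp u + a - 1"
        and f' = "\<lambda>u. a * (exp (a * u) - exp u)"])
    show "((\<lambda>u. exp (a * u) - a * exp u + a - 1) \<longlongrightarrow> 0) (at_right 0)"
      by (auto intro!: tendsto_eq_intros)
  qed (use assms in \<open>auto intro!: derivative_eq_intros simp: algebra_simps\<close>)
  then show ?thesis
    using assms by (simp add: powr_def algebra_simps)
qed

lemma inequality_if_neg:
  fixes k p x :: real
  assumes k: "k < -2" and p: "p < 0" and x: "x > 0"
  shows "2 / (k + 2) * (sinh x / x) powr (k * p) + k / (k + 2) * (tanh x / x) powr p < 1"
proof -
  define S T where "S = sinh x / x" and "T = tanh x / x"
  have "S > 1" "T > 0"
    using x sinh_div_gt_1[OF x] by (auto simp: S_def T_def)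
  \<comment> \<open>This \<open>w\<close> bounds \<open>T powr p\<close> from above, and
    \<open>w powr (- k / 2)\<close> is exactly \<open>S powr (k * p)\<close>.\<close>
  define w where "w = S powr (- 2 * p)"
  have "w > 1"
    unfolding w_def using \<open>S > 1\<close> p by (intro gr_one_powr) auto
  have "T powr p = (1 / T) powr (- p)"
    using \<open>T > 0\<close> by (simp add: powr_minus powr_divide divide_simps)
  also have "\<dots> < (S ^ 2) powr (- p)"
    using inverse_tanh_div_less[OF x] \<open>T > 0\<close> p unfolding S_def T_def
    by (intro powr_less_mono2) (auto simp del: divide_divide_eq_right)
  also have "\<dots> = w"
    unfolding w_def using \<open>S > 1\<close> by (simp add: powr_powr flip: powr_numeral)
  finally have "k * w < k * T powr p"
    using k by simp
  have "1 + (- k / 2) * (w - 1) < w powr (- k / 2)"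
    using \<open>w > 1\<close> k by (intro Bernoulli_powr) auto
  also have "w powr (- k / 2) = S powr (k * p)"
    unfolding w_def by (simp add: powr_powr mult_ac)
  finally have "k + 2 - k * w < 2 * S powr (k * p)"
    by (simp add: field_simps)
  with \<open>k * w < k * T powr p\<close> have "2 * S powr (k * p) + k * T powr p > k + 2"
    by linarith
  \<comment> \<open>The divisor \<open>k + 2\<close> is negative, so the inequality is
    reversed.\<close>
  then have "(2 * S powr (k * p) + k * T powr p) / (k + 2) < (k + 2) / (k + 2)"
    using k by (intro divide_strict_right_mono_neg) auto
  then show ?thesis
    using k by (simp add: S_def T_def add_divide_distrib)
qed

section \<open>Necessity, by fourth-order expansion at 0\<close>

text \<open>From \<open>S = 1 + x^2/6 + x^4/120 + ...\<close>, the coefficient of \<open>x^4\<close>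
  is \<open>r/120 + r (r - 1)/72\<close>.\<close>

lemma sinh_div_powr_expansion:
  fixes r :: real
  shows "((\<lambda>x. ((sinh x / x) powr r - 1 - r * x ^ 2 / 6) / x ^ 4) \<longlongrightarrow> r ^ 2 / 72 - r / 180) (at_right 0)"
  by (real_asymp simp: field_simps power2_eq_square)

text \<open>From \<open>T = 1 - x^2/3 + 2 x^4/15 - ...\<close>, the coefficient is
  \<open>2 r/15 + r (r - 1)/18\<close>.\<close>

lemma tanh_div_powr_expansion:
  fixes r :: real
  shows "((\<lambda>x. ((tanh x / x) powr r - 1 + r * x ^ 2 / 3) / x ^ 4) \<longlongrightarrow> r ^ 2 / 18 + 7 * r / 90) (at_right 0)"
  by (real_asymp simp: field_simps power2_eq_square)

text \<open>The weights sum to 1 and the \<open>x^2\<close> terms cancel in the weighted sum, so the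
  left-hand side minus 1, divided by \<open>x^4\<close>, has a limit \<open>L\<close>, which cannot
  be positive.\<close>

lemma ge_if_inequality:
  fixes k p :: real
  assumes k: "k < -2" and p: "p > 0"
    and less: "\<And>x. x > 0 \<Longrightarrow>
      2 / (k + 2) * (sinh x / x) powr (k * p) + k / (k + 2) * (tanh x / x) powr p < 1"
  shows "p \<ge> - 12 / (5 * (k + 2))"
proof -
  have "2 / (k + 2) + k / (k + 2) = (k + 2) / (k + 2)"
    by (simp only: add_divide_distrib add.commute)
  then have sum1: "2 / (k + 2) + k / (k + 2) = 1"
    using k by simp
  define u where "u = inverse (k + 2)"
  have u: "2 / (k + 2) = 2 * u" "k / (k + 2) = k * u" "k * p / (k + 2) = k * p * u"
    by (simp_all only: u_def divide_inverse)
  have *: "2 / (k + 2) * ((a - 1 - k * p * y / 6) / z) + k / (k + 2) * ((b - 1 + p * y / 3) / z)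
      = (2 / (k + 2) * a + k / (k + 2) * b - (2 / (k + 2) + k / (k + 2))) / z" for a b y z :: real
    unfolding u by (simp add: add_divide_distrib diff_divide_distrib right_diff_distrib distrib_left)
  define L where "L = 2 / (k + 2) * ((k * p) ^ 2 / 72 - k * p / 180) + k / (k + 2) * (p ^ 2 / 18 + 7 * p / 90)"
  have "((\<lambda>x. 2 / (k + 2) * (((sinh x / x) powr (k * p) - 1 - k * p * x ^ 2 / 6) / x ^ 4)
      + k / (k + 2) * (((tanh x / x) powr p - 1 + p * x ^ 2 / 3) / x ^ 4)) \<longlongrightarrow> L) (at_right 0)"
    unfolding L_def
    by (intro tendsto_intros sinh_div_powr_expansion tanh_div_powr_expansion)
  moreover have "\<forall>\<^sub>F x in at_right 0. 2 / (k + 2) * (((sinh x / x) powr (k * p) - 1 - k * p * x ^ 2 / 6) / x ^ 4)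
      + k / (k + 2) * (((tanh x / x) powr p - 1 + p * x ^ 2 / 3) / x ^ 4) \<le> 0"
  proof (rule eventually_at_rightI)
    fix x :: real assume "x \<in> {0<..<1}"
    then have x: "x > 0" by simp
    have "2 / (k + 2) * (((sinh x / x) powr (k * p) - 1 - k * p * x ^ 2 / 6) / x ^ 4)
      + k / (k + 2) * (((tanh x / x) powr p - 1 + p * x ^ 2 / 3) / x ^ 4)
      = (2 / (k + 2) * (sinh x / x) powr (k * p) + k / (k + 2) * (tanh x / x) powr p
          - (2 / (k + 2) + k / (k + 2))) / x ^ 4"
      by (rule *)
    also have "\<dots> \<le> 0"
      unfolding sum1 using less[OF x] by (intro divide_nonpos_nonneg) auto
    finally show "2 / (k + 2) * (((sinh x / x) powr (k * p) - 1 - k * p * x ^ 2 / 6) / x ^ 4)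
      + k / (k + 2) * (((tanh x / x) powr p - 1 + p * x ^ 2 / 3) / x ^ 4) \<le> 0" .
  qed simp
  ultimately have "L \<le> 0"
    by (intro tendsto_upperbound) auto
  \<comment> \<open>The first factor is positive, so \<open>L \<le> 0\<close> forces
    \<open>(k + 2) * p \<le> - 36 / 15 = - 12 / 5\<close>.\<close>
  have "L = k * p / (k + 2) * ((k + 2) * p / 36 + 1 / 15)"
    unfolding L_def u by (simp add: field_simps power2_eq_square)
  moreover have "k * p / (k + 2) > 0"
    using k p by (simp add: divide_neg_neg mult_neg_pos)
  ultimately have "(k + 2) * p / 36 + 1 / 15 \<le> 0"
    using \<open>L \<le> 0\<close> by (metis mult_pos_pos not_less)
  then show ?thesis
    using k by (simp add: field_simps)
qed

theorem theorem3p4: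
  fixes k p :: real
  assumes "k < -2" and "p \<noteq> 0"
  shows "(\<forall>x::real. x > 0 \<longrightarrow>
            2 / (k + 2) * (sinh x / x) powr (k * p) + k / (k + 2) * (tanh x / x) powr p < 1)
         \<longleftrightarrow> (p < 0 \<or> p \<ge> - 12 / (5 * (k + 2)))"
  using ge_if_inequality[of k p] inequality_if_neg[of k p] inequality_if_ge[of k p] assms
  by (cases "p < 0") auto

end
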